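(* Let $P_n(x)=\sum_{\sigma\in\mathfrak{S}_n}x^{\mathrm{wexx}(\sigma)}$ and $Q_n(x)=\sum_{\sigma\in\mathfrak{S}_n}x^{\mathrm{cdes}(\sigma)}$. Then both $\sum_{n\ge0}P_n(x)t^n$ and $\sum_{n\ge0}Q_n(x)t^n$ equal the Jacobi-type continued fraction $$\cfrac{1}{1-1\cdot t-\cfrac{1\cdot1\,t^2}{1-(2+x)t-\cfrac{2(1+x)t^2}{1-(3+2x)t-\cfrac{3(1+2x)t^2}{1-\cdots}}}}$$ with coefficients $\gamma_n=(n+1)+nx$ for $n\ge0$ and $\beta_n=n\,(1+(n-1)x)$ for $n\ge1$. Consequently $P_n(x)=Q_n(x)$ for all $n\ge0$, i.e. the statistics wexx and cdes are equidistributed on $\mathfrak{S}_n$.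
   Context: $\mathfrak{S}_n$ is the set of permutations of $[n]$. $\mathrm{wexx}(\sigma)$ is the number of $j\in[n]$ with $j\le\sigma(j)$ such that there exist $i<j<k$ with $\sigma(i)>\sigma(j)>\sigma(k)$ (weak excedances that are midpoints of a decreasing subsequence of length 3). $\mathrm{cdes}(\sigma)$ (cycle descent number) is the number of $i\in[n]$ with $i>\sigma(i)$ such that $\sigma(i)$ is not the smallest element of its cycle. The Jacobi-type continued fraction with coefficients $(\gamma_n)_{n\ge0},(\beta_n)_{n\ge1}$ is $1/(1-\gamma_0t-\beta_1t^2/(1-\gamma_1t-\beta_2t^2/(1-\cdots)))$. *)

theory Defs
  imports
    "HOL-Computational_Algebra.Polynomial"
    "HOL-Computational_Algebra.Formal_Power_Series"
    "HOL-Combinatorics.Orbits"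
begin

text \<open>A permutation of \<open>[n]\<close> is a function \<open>\<sigma> :: nat \<Rightarrow> nat\<close> with
  \<open>\<sigma> permutes {1..n}\<close>.\<close>

definition wexx :: "nat \<Rightarrow> (nat \<Rightarrow> nat) \<Rightarrow> nat" where
  "wexx n \<sigma> = card {j \<in> {1..n}. j \<le> \<sigma> j \<and>
     (\<exists>i\<in>{1..n}. \<exists>k\<in>{1..n}. i < j \<and> j < k \<and> \<sigma> i > \<sigma> j \<and> \<sigma> j > \<sigma> k)}"

definition cdes :: "nat \<Rightarrow> (nat \<Rightarrow> nat) \<Rightarrow> nat" where
  "cdes n \<sigma> = card {i \<in> {1..n}. i > \<sigma> i \<and> \<sigma> i \<noteq> Min (orbit \<sigma> (\<sigma> i))}"

text \<open>The indeterminate \<open>x\<close> of the polynomial ring.\<close>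

abbreviation poly_x :: "int poly" where
  "poly_x \<equiv> [:0, 1:]"

definition wexx_poly :: "nat \<Rightarrow> int poly" where
  "wexx_poly n = (\<Sum>\<sigma> | \<sigma> permutes {1..n}. poly_x ^ wexx n \<sigma>)"

definition cdes_poly :: "nat \<Rightarrow> int poly" where
  "cdes_poly n = (\<Sum>\<sigma> | \<sigma> permutes {1..n}. poly_x ^ cdes n \<sigma>)"

text \<open>The \<open>N\<close>-th convergent of the Jacobi-type continued fraction, obtained by truncating
  after \<open>N\<close> levels (the remaining tail is replaced by \<open>0\<close>). The value \<open>\<beta> 0\<close> is never used.
  The coefficient ring need not be a field: every denominator has constant term 1, and
  \<open>fps_right_inverse f 1\<close> is the reciprocal of such an \<open>f\<close>.\<close>

primrec jfrac_convergent ::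
    "(nat \<Rightarrow> 'a::comm_ring_1) \<Rightarrow> (nat \<Rightarrow> 'a) \<Rightarrow> nat \<Rightarrow> 'a fps" where
  "jfrac_convergent \<gamma> \<beta> 0 = 0"
| "jfrac_convergent \<gamma> \<beta> (Suc N) =
     fps_right_inverse
       (1 - fps_const (\<gamma> 0) * fps_X
          - fps_const (\<beta> 1) * fps_X ^ 2
            * jfrac_convergent (\<lambda>n. \<gamma> (Suc n)) (\<lambda>n. \<beta> (Suc n)) N) 1"

text \<open>The infinite continued fraction is the limit of its convergents in the
  \<open>t\<close>-adic topology; the limit always exists, see below.\<close>

definition jfrac :: "(nat \<Rightarrow> 'a::comm_ring_1) \<Rightarrow> (nat \<Rightarrow> 'a) \<Rightarrow> 'a fps" where
  "jfrac \<gamma> \<beta> = lim (jfrac_convergent \<gamma> \<beta>)"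

context includes fps_syntax
begin

lemma jfrac_convergent_Suc_mult:
  "(1 - fps_const (\<gamma> 0) * fps_X
      - fps_const (\<beta> 1) * fps_X ^ 2
        * jfrac_convergent (\<lambda>n. \<gamma> (Suc n)) (\<lambda>n. \<beta> (Suc n)) N)
   * jfrac_convergent \<gamma> \<beta> (Suc N) = 1"
  unfolding jfrac_convergent.simps
  by (rule fps_right_inverse) (simp add: power2_eq_square mult.assoc)

lemma jfrac_convergent_stable:
  "n < N \<Longrightarrow> jfrac_convergent \<gamma> \<beta> (Suc N) $ n = jfrac_convergent \<gamma> \<beta> N $ n"
proof (induction N arbitrary: \<gamma> \<beta> n)
  case 0
  then show ?case by simp
next
  case (Suc N)
  let ?\<gamma> = "\<lambda>n. \<gamma> (Suc n)" and ?\<beta> = "\<lambda>n. \<beta> (Suc n)"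
  define a where "a = jfrac_convergent ?\<gamma> ?\<beta> N"
  define b where "b = jfrac_convergent ?\<gamma> ?\<beta> (Suc N)"
  define A where "A = jfrac_convergent \<gamma> \<beta> (Suc N)"
  define B where "B = jfrac_convergent \<gamma> \<beta> (Suc (Suc N))"
  define D where "D = 1 - fps_const (\<gamma> 0) * fps_X"
  define c where "c = fps_const (\<beta> 1) * (fps_X :: 'a fps) ^ 2"
  have A: "(D - c * a) * A = 1"
    unfolding A_def a_def D_def c_def by (rule jfrac_convergent_Suc_mult)
  have B: "(D - c * b) * B = 1"
    unfolding B_def b_def D_def c_def by (rule jfrac_convergent_Suc_mult)
  have "B - A = ((D - c * a) * A) * B - ((D - c * b) * B) * A"
    by (simp only: A B mult_1_left)
  also have "\<dots> = fps_X * ((fps_const (\<beta> 1) * fps_X * A * B) * (b - a))"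
    by (simp add: c_def algebra_simps power2_eq_square)
  finally have BA: "B - A = fps_X * ((fps_const (\<beta> 1) * fps_X * A * B) * (b - a))" .
  have "(b - a) $ m = 0" if "m < N" for m
    using Suc.IH[OF that, of ?\<gamma> ?\<beta>] by (simp add: a_def b_def)
  then have "(F * (b - a)) $ m = 0" if "m < N" for m and F :: "'a fps"
    using that by (simp add: fps_mult_nth)
  then have "(B - A) $ n = 0"
    unfolding BA using Suc.prems by (cases n) auto
  then show ?case by (simp add: A_def B_def)
qed

lemma jfrac_convergent_nth:
  assumes "n < N"
  shows "jfrac_convergent \<gamma> \<beta> N $ n = jfrac_convergent \<gamma> \<beta> (Suc n) $ n"
proof -
  have "Suc n \<le> N" using assms by simp
  then show ?thesis
  proof (induction N rule: dec_induct)
    case (step M)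
    then have "n < M" by simp
    from jfrac_convergent_stable[OF this, of \<gamma> \<beta>] step.IH show ?case by (rule trans)
  qed (rule refl)
qed

lemma jfrac_convergent_LIMSEQ: "jfrac_convergent \<gamma> \<beta> \<longlonglongrightarrow> jfrac \<gamma> \<beta>"
proof -
  have "jfrac_convergent \<gamma> \<beta> \<longlonglongrightarrow> Abs_fps (\<lambda>n. jfrac_convergent \<gamma> \<beta> (Suc n) $ n)"
  proof (rule tendsto_fpsI)
    fix n
    show "\<forall>\<^sub>F N in sequentially. jfrac_convergent \<gamma> \<beta> N $ n
        = Abs_fps (\<lambda>n. jfrac_convergent \<gamma> \<beta> (Suc n) $ n) $ n"
      using eventually_gt_at_top[of n]
      by eventually_elim (simp only: fps_nth_Abs_fps, rule jfrac_convergent_nth)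
  qed
  then show ?thesis
    unfolding jfrac_def by (metis limI)
qed

end

end

theory Submission
  imports Defs
begin

text \<open>Read the rook placement \<open>{(i, \<sigma> i)}\<close> of a permutation through its corners \<open>[m]\<^sup>2\<close>, \<open>m = 0, \<dots>, n\<close>. The number
  \<open>k\<close> of free rows (equally, free columns) of the corner traces a Motzkin path, so a statistic that splits into
  contributions depending only on the corners has a J-fraction as its generating function as soon as the
  total weight of the steps out of a placement depends on \<open>k\<close> alone.

  Every weak excedance \<open>j\<close> preceded by a larger value is, by counting, also followed by a smaller one, so
  \<open>wexx\<close> counts the weak excedances that are not left-to-right maxima. When the new column \<open>m\<close> is filled in
  one of \<open>k\<close> free rows, only the topmost of them makes \<open>m\<close> a left-to-right maximum, which gives \<open>1 + (k - 1) x\<close>.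

  Each nontrivial cycle has one drop to its minimum and one drop from its maximum, so \<open>cdes\<close> counts the drops
  \<open>i > \<sigma> i\<close> with \<open>i\<close> not maximal in its cycle. A placement is a union of cycles and \<open>k\<close> paths; joining the end of
  one of the paths to the start of another through \<open>m\<close> costs \<open>x\<close>, closing it up to a cycle costs \<open>1\<close>, which again
  gives \<open>1 + (k - 1) x\<close>.\<close>

section \<open>Jacobi-type continued fractions\<close>

context includes fps_syntax
begin

text \<open>Convergence in the t-adic topology makes each coefficient eventually constant, and
  \<open>jfrac_convergent_nth\<close> fixes coefficient n from convergent n + 1 on.\<close>

lemma jfrac_nth:
  assumes "n < N"
  shows "jfrac \<gamma> \<beta> $ n = jfrac_convergent \<gamma> \<beta> N $ n"
proof -
  have "\<forall>\<^sub>F M in sequentially. jfrac_convergent \<gamma> \<beta> M $ n = jfrac \<gamma> \<beta> $ n"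
    using jfrac_convergent_LIMSEQ[of \<gamma> \<beta>] by (simp add: tendsto_fps_iff)
  then obtain M0 where M0: "\<And>M. M \<ge> M0 \<Longrightarrow> jfrac_convergent \<gamma> \<beta> M $ n = jfrac \<gamma> \<beta> $ n"
    by (auto simp: eventually_sequentially)
  have "jfrac \<gamma> \<beta> $ n = jfrac_convergent \<gamma> \<beta> (max M0 (Suc n)) $ n"
    using M0[of "max M0 (Suc n)"] by simp
  also have "\<dots> = jfrac_convergent \<gamma> \<beta> (Suc n) $ n"
    by (rule jfrac_convergent_nth) simp
  also have "\<dots> = jfrac_convergent \<gamma> \<beta> N $ n"
    using jfrac_convergent_nth[OF assms, of \<gamma> \<beta>] by simp
  finally show ?thesis .
qed

text \<open>Convergents satisfy this equation when the outer one has one level more than the inner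
  one. Coefficient n of a product involves only coefficients up to n, so both limits may be replaced
  by such convergents.\<close>

lemma jfrac_unfold:
  "(1 - fps_const (\<gamma> 0) * fps_X
      - fps_const (\<beta> 1) * fps_X ^ 2 * jfrac (\<lambda>n. \<gamma> (Suc n)) (\<lambda>n. \<beta> (Suc n)))
   * jfrac \<gamma> \<beta> = 1" (is "(?A - ?B * ?J') * ?J = 1")
proof (rule fps_ext)
  fix n
  let ?C' = "jfrac_convergent (\<lambda>n. \<gamma> (Suc n)) (\<lambda>n. \<beta> (Suc n)) (Suc n)"
    and ?C = "jfrac_convergent \<gamma> \<beta> (Suc (Suc n))"
  have *: "(?A - ?B * ?J') $ i = (?A - ?B * ?C') $ i" if "i \<le> n" for i
  proof -
    have "(?B * ?J') $ i = (?B * ?C') $ i"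
      unfolding fps_mult_nth[of ?B]
      by (intro sum.cong refl arg_cong2[of _ _ _ _ "(*)"] jfrac_nth) (use that in auto)
    then show ?thesis by simp
  qed
  have "((?A - ?B * ?J') * ?J) $ n = ((?A - ?B * ?C') * ?C) $ n"
    unfolding fps_mult_nth[of "?A - _"]
    by (intro sum.cong refl arg_cong2[of _ _ _ _ "(*)"] jfrac_nth *) auto
  also have "\<dots> = 1 $ n"
    by (simp only: jfrac_convergent_Suc_mult)
  finally show "((?A - ?B * ?J') * ?J) $ n = 1 $ n" .
qed

text \<open>The generating function of the \<open>k\<close>-th column is \<open>t\<^sup>k J\<^sub>0 J\<^sub>1 \<dots> J\<^sub>k\<close>, where \<open>J\<^sub>i\<close> is the continued
  fraction with the first \<open>i\<close> levels removed.\<close>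

lemma jfrac_eq_column_zero:
  fixes M :: "nat \<Rightarrow> nat \<Rightarrow> 'a::comm_ring_1"
  assumes M0: "\<And>k. M 0 k = (if k = 0 then 1 else 0)"
    and MSuc: "\<And>n k. M (Suc n) k =
      (if k = 0 then 0 else M n (k - 1)) + \<gamma> k * M n k + \<beta> (Suc k) * M n (Suc k)"
  shows "Abs_fps (\<lambda>n. M n 0) = jfrac \<gamma> \<beta>"
proof -
  define J where "J k = jfrac (\<lambda>n. \<gamma> (n + k)) (\<lambda>n. \<beta> (n + k))" for k
  define D where "D k = fps_X ^ k * (\<Prod>i\<le>k. J i)" for k
  have J: "J k = 1 + fps_const (\<gamma> k) * fps_X * J k
      + fps_const (\<beta> (Suc k)) * fps_X ^ 2 * J k * J (Suc k)" for k
    using jfrac_unfold[of "\<lambda>n. \<gamma> (n + k)" "\<lambda>n. \<beta> (n + k)"]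
    by (simp add: J_def algebra_simps)
  have D0: "D 0 = 1 + fps_X * (fps_const (\<gamma> 0) * D 0 + fps_const (\<beta> 1) * D 1)"
    using J[of 0] by (simp add: D_def algebra_simps power2_eq_square)
  have DSuc: "D (Suc k) = fps_X * (D k + fps_const (\<gamma> (Suc k)) * D (Suc k)
      + fps_const (\<beta> (Suc (Suc k))) * D (Suc (Suc k)))" for k
  proof -
    have "D (Suc k) = fps_X * D k * J (Suc k)"
      by (simp add: D_def algebra_simps)
    also have "\<dots> = fps_X * D k * (1 + fps_const (\<gamma> (Suc k)) * fps_X * J (Suc k)
        + fps_const (\<beta> (Suc (Suc k))) * fps_X ^ 2 * J (Suc k) * J (Suc (Suc k)))"
      by (subst J) (rule refl)
    also have "\<dots> = fps_X * (D k + fps_const (\<gamma> (Suc k)) * D (Suc k)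
        + fps_const (\<beta> (Suc (Suc k))) * D (Suc (Suc k)))"
      by (simp add: D_def algebra_simps power2_eq_square)
    finally show ?thesis .
  qed
  \<comment> \<open>In \<open>D0\<close> and \<open>DSuc\<close> everything but the initial 1
    carries a factor \<open>fps_X\<close>, so comparing coefficients of index n + 1 yields exactly
    \<open>MSuc\<close>, and the constant terms yield \<open>M0\<close>.\<close>
  have "D k $ n = M n k" for n k
  proof (induction n arbitrary: k)
    case 0
    show ?case
    proof (cases k)
      case 0
      then show ?thesis by (subst 0, subst D0) (simp add: M0)
    next
      case (Suc k')
      then show ?thesis by (subst Suc, subst DSuc) (simp add: M0)
    qed
  next
    case (Suc n)
    show ?case
    proof (cases k)
      case 0
      then show ?thesis by (subst 0, subst D0) (simp add: MSuc Suc)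
    next
      case (Suc k')
      then show ?thesis by (subst Suc, subst DSuc) (simp add: MSuc Suc.IH)
    qed
  qed
  then have "Abs_fps (\<lambda>n. M n 0) = D 0"
    by (intro fps_ext) simp
  then show ?thesis by (simp add: D_def J_def)
qed

end

section \<open>Weighted rook placements\<close>

text \<open>These are the partial injections of [n]. As relations, they have corners that are plain
  intersections and paths given by the reflexive transitive closure.\<close>

definition rooks :: "nat \<Rightarrow> (nat \<times> nat) set set" where
  "rooks n = {R. R \<subseteq> {1..n} \<times> {1..n} \<and> single_valued R \<and> single_valued (R\<inverse>)}"

definition corner :: "nat \<Rightarrow> (nat \<times> nat) set \<Rightarrow> (nat \<times> nat) set" where
  "corner m R = R \<inter> {1..m} \<times> {1..m}"

definition free_rows :: "nat \<Rightarrow> (nat \<times> nat) set \<Rightarrow> nat set" where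
  "free_rows n R = {1..n} - Domain R"

definition free_cols :: "nat \<Rightarrow> (nat \<times> nat) set \<Rightarrow> nat set" where
  "free_cols n R = {1..n} - Range R"

lemma rooksD:
  assumes "R \<in> rooks n"
  shows "\<And>i j. (i, j) \<in> R \<Longrightarrow> 1 \<le> i \<and> i \<le> n \<and> 1 \<le> j \<and> j \<le> n"
    and "\<And>i j j'. (i, j) \<in> R \<Longrightarrow> (i, j') \<in> R \<Longrightarrow> j = j'"
    and "\<And>i i' j. (i, j) \<in> R \<Longrightarrow> (i', j) \<in> R \<Longrightarrow> i = i'"
  using assms by (auto simp: rooks_def single_valued_def)

lemma finite_rooks: "finite (rooks n)"
  by (rule finite_subset[of _ "Pow ({1..n} \<times> {1..n})"]) (auto simp: rooks_def)

lemma finite_rook: "R \<in> rooks n \<Longrightarrow> finite R"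
  by (rule finite_subset[of _ "{1..n} \<times> {1..n}"]) (auto simp: rooks_def)

lemma card_Domain_rook: "R \<in> rooks n \<Longrightarrow> card (Domain R) = card R"
  unfolding Domain_fst by (rule card_image) (auto simp: inj_on_def dest: rooksD)

lemma card_Range_rook: "R \<in> rooks n \<Longrightarrow> card (Range R) = card R"
  unfolding Range_snd by (rule card_image) (auto simp: inj_on_def dest: rooksD)

lemma Domain_rook: "R \<in> rooks n \<Longrightarrow> Domain R \<subseteq> {1..n}"
  and Range_rook: "R \<in> rooks n \<Longrightarrow> Range R \<subseteq> {1..n}"
  by (auto simp: rooks_def)

lemma card_rook_le: "R \<in> rooks n \<Longrightarrow> card R \<le> n"
  using card_mono[OF finite_atLeastAtMost Domain_rook, of R n] by (simp add: card_Domain_rook)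

lemma finite_free: "finite (free_rows n R)" "finite (free_cols n R)"
  by (auto simp: free_rows_def free_cols_def)

lemma card_free_rows: "R \<in> rooks n \<Longrightarrow> card (free_rows n R) = n - card R"
  unfolding free_rows_def
  by (subst card_Diff_subset)
    (use Domain_rook[of R n] in \<open>auto simp: card_Domain_rook finite_rook finite_Domain\<close>)

lemma card_free_cols: "R \<in> rooks n \<Longrightarrow> card (free_cols n R) = n - card R"
  unfolding free_cols_def
  by (subst card_Diff_subset)
    (use Range_rook[of R n] in \<open>auto simp: card_Range_rook finite_rook finite_Range\<close>)

lemma corner_in_rooks: "R \<in> rooks n \<Longrightarrow> corner m R \<in> rooks m"
  by (auto simp: rooks_def corner_def single_valued_def)

lemma corner_self: "R \<in> rooks n \<Longrightarrow> corner n R = R"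
  by (auto simp: rooks_def corner_def)

lemma corner_corner: "m \<le> n \<Longrightarrow> corner m (corner n R) = corner m R"
  by (auto simp: corner_def)

text \<open>The cases are distinguished by how row m and column m are occupied. If k rows of R are
  free, adding no rook leads to height k + 1, one rook keeps k, and two rooks lead to k - 1: the up,
  level and down steps of the Motzkin path.\<close>

lemma rook_extensions:
  assumes R: "R \<in> rooks n"
  defines "O' \<equiv> free_rows n R" and "V \<equiv> free_cols n R" and "m \<equiv> Suc n"
  shows "{S \<in> rooks (Suc n). corner n S = R} =
    {R} \<union> {insert (m, m) R} \<union> (\<lambda>j. insert (j, m) R) ` O' \<union> (\<lambda>v. insert (m, v) R) ` V
    \<union> (\<lambda>(j, v). insert (j, m) (insert (m, v) R)) ` (O' \<times> V)" (is "?L = ?U")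
proof (intro equalityI subsetI)
  fix S assume "S \<in> ?L"
  then have S: "S \<in> rooks m" and SR: "corner n S = R" by (auto simp: m_def)
  have SR': "(a, b) \<in> R \<longleftrightarrow> (a, b) \<in> S \<and> a \<noteq> m \<and> b \<noteq> m" for a b
    using rooksD(1)[OF S, of a b] by (auto simp: SR[symmetric] corner_def m_def)
  have row: "a \<in> O'" if "(a, m) \<in> S" "a \<noteq> m" for a
    using rooksD(1)[OF S that(1)] rooksD(2)[OF S that(1)] that(2)
    by (fastforce simp: O'_def free_rows_def m_def SR')
  have col: "b \<in> V" if "(m, b) \<in> S" "b \<noteq> m" for b
    using rooksD(1)[OF S that(1)] rooksD(3)[OF S that(1)] that(2)
    by (fastforce simp: V_def free_cols_def m_def SR')
  show "S \<in> ?U"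
  proof (cases "(m, m) \<in> S")
    case True
    then have "S = insert (m, m) R"
      using rooksD(2,3)[OF S] by (auto simp: SR')
    then show ?thesis by simp
  next
    case mm: False
    show ?thesis
    proof (cases "m \<in> Range S")
      case True
      then obtain a where a: "(a, m) \<in> S" by auto
      then have "a \<noteq> m" using mm by auto
      show ?thesis
      proof (cases "m \<in> Domain S")
        case True
        then obtain b where b: "(m, b) \<in> S" by auto
        then have "b \<noteq> m" using mm by auto
        have "S = insert (a, m) (insert (m, b) R)"
          using a b rooksD(2,3)[OF S] by (auto simp: SR')
        then show ?thesis using row[OF a \<open>a \<noteq> m\<close>] col[OF b \<open>b \<noteq> m\<close>] by auto
      next
        case False
        then have "S = insert (a, m) R"
          using a rooksD(2,3)[OF S] by (auto simp: SR')
        then show ?thesis using row[OF a \<open>a \<noteq> m\<close>] by auto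
      qed
    next
      case F: False
      show ?thesis
      proof (cases "m \<in> Domain S")
        case True
        then obtain b where b: "(m, b) \<in> S" by auto
        then have "b \<noteq> m" using mm by auto
        have "S = insert (m, b) R"
          using F b rooksD(2,3)[OF S] by (auto simp: SR')
        then show ?thesis using col[OF b \<open>b \<noteq> m\<close>] by auto
      next
        case False
        then have "S = R" using F by (auto simp: SR')
        then show ?thesis by simp
      qed
    qed
  qed
next
  fix S assume S: "S \<in> ?U"
  have 1: "corner n S = R"
    using S R by (auto simp: corner_def rooks_def m_def)
  have bd: "(m, a) \<notin> R" "(a, m) \<notin> R" for a
    using rooksD(1)[OF R, of a m] rooksD(1)[OF R, of m a] by (auto simp: m_def)
  have OV: "m \<notin> O'" "m \<notin> V"
    by (auto simp: O'_def V_def m_def free_rows_def free_cols_def)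
  have "S \<subseteq> {1..Suc n} \<times> {1..Suc n}"
    using S R by (auto simp: rooks_def m_def O'_def V_def free_rows_def free_cols_def)
  moreover have "single_valued S" "single_valued (S\<inverse>)"
    using S rooksD(2,3)[OF R] bd OV
    by (auto simp: single_valued_def O'_def V_def free_rows_def free_cols_def)
  ultimately show "S \<in> ?L" using 1 by (auto simp: rooks_def)
qed

text \<open>R has no rook in row or column m, and m lies in neither \<open>O'\<close> nor
  \<open>V\<close>; hence the five families are disjoint and their parametrisations
  injective.\<close>

lemma sum_rook_extensions:
  fixes g :: "(nat \<times> nat) set \<Rightarrow> 'a::comm_monoid_add"
  assumes R: "R \<in> rooks n"
  defines "O' \<equiv> free_rows n R" and "V \<equiv> free_cols n R" and "m \<equiv> Suc n"
  shows "(\<Sum>S | S \<in> rooks (Suc n) \<and> corner n S = R. g S) =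
    g R + g (insert (m, m) R) + (\<Sum>j\<in>O'. g (insert (j, m) R)) + (\<Sum>v\<in>V. g (insert (m, v) R))
    + (\<Sum>j\<in>O'. \<Sum>v\<in>V. g (insert (j, m) (insert (m, v) R)))"
proof -
  have bd: "(m, a) \<notin> R" "(a, m) \<notin> R" for a
    using rooksD(1)[OF R, of a m] rooksD(1)[OF R, of m a] by (auto simp: m_def)
  have OV: "m \<notin> O'" "m \<notin> V"
    by (auto simp: O'_def V_def m_def free_rows_def free_cols_def)
  have fin: "finite O'" "finite V"
    by (auto simp: O'_def V_def finite_free)
  have inj1: "inj_on (\<lambda>j. insert (j, m) R) O'"
    by (rule inj_onI) (use bd in blast)
  have inj2: "inj_on (\<lambda>v. insert (m, v) R) V"
    by (rule inj_onI) (use bd in blast)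
  have inj3: "inj_on (\<lambda>(j, v). insert (j, m) (insert (m, v) R)) (O' \<times> V)"
  proof (rule inj_onI, clarify)
    fix j v j' v'
    assume *: "j \<in> O'" "v \<in> V" "j' \<in> O'" "v' \<in> V"
      and eq: "insert (j, m) (insert (m, v) R) = insert (j', m) (insert (m, v') R)"
    have "(j, m) \<in> insert (j', m) (insert (m, v') R)" "(m, v) \<in> insert (j', m) (insert (m, v') R)"
      unfolding eq[symmetric] by auto
    then show "j = j' \<and> v = v'" using * bd OV by auto
  qed
  let ?E1 = "{R}" and ?E2 = "{insert (m, m) R}" and ?E3 = "(\<lambda>j. insert (j, m) R) ` O'"
    and ?E4 = "(\<lambda>v. insert (m, v) R) ` V"
    and ?E5 = "(\<lambda>(j, v). insert (j, m) (insert (m, v) R)) ` (O' \<times> V)"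
  have d1: "?E1 \<inter> ?E2 = {}" using bd by auto
  have d2: "(?E1 \<union> ?E2) \<inter> ?E3 = {}"
  proof -
    have "(j, m) \<notin> S" if "S \<in> ?E1 \<union> ?E2" "j \<in> O'" for j S
      using that bd OV by auto
    then show ?thesis by blast
  qed
  have d3: "(?E1 \<union> ?E2 \<union> ?E3) \<inter> ?E4 = {}"
  proof -
    have "(m, v) \<notin> S" if "S \<in> ?E1 \<union> ?E2 \<union> ?E3" "v \<in> V" for v S
      using that bd OV by auto
    then show ?thesis by blast
  qed
  have d4: "(?E1 \<union> ?E2 \<union> ?E3 \<union> ?E4) \<inter> ?E5 = {}"
  proof -
    have *: "\<not> ((j, m) \<in> S \<and> (m, v) \<in> S)"
      if "S \<in> ?E1 \<union> ?E2 \<union> ?E3 \<union> ?E4" "j \<in> O'" "v \<in> V" for j v S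
      using that bd OV by auto
    have "S \<notin> ?E5" if "S \<in> ?E1 \<union> ?E2 \<union> ?E3 \<union> ?E4" for S
    proof
      assume "S \<in> ?E5"
      then obtain j v where "j \<in> O'" "v \<in> V" "S = insert (j, m) (insert (m, v) R)" by auto
      then show False using *[OF that, of j v] by simp
    qed
    then show ?thesis unfolding disjoint_iff by simp
  qed
  have "(\<Sum>S | S \<in> rooks (Suc n) \<and> corner n S = R. g S)
      = sum g (?E1 \<union> ?E2 \<union> ?E3 \<union> ?E4 \<union> ?E5)"
    using rook_extensions[OF R] by (simp add: O'_def V_def m_def)
  also have "\<dots> = sum g (?E1 \<union> ?E2 \<union> ?E3 \<union> ?E4) + sum g ?E5"
    by (rule sum.union_disjoint) (use fin d4 in auto)
  also have "sum g (?E1 \<union> ?E2 \<union> ?E3 \<union> ?E4) = sum g (?E1 \<union> ?E2 \<union> ?E3) + sum g ?E4"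
    by (rule sum.union_disjoint) (use fin d3 in auto)
  also have "sum g (?E1 \<union> ?E2 \<union> ?E3) = sum g (?E1 \<union> ?E2) + sum g ?E3"
    by (rule sum.union_disjoint) (use fin d2 in auto)
  also have "sum g (?E1 \<union> ?E2) = sum g ?E1 + sum g ?E2"
    by (rule sum.union_disjoint) (use d1 in auto)
  also have "sum g ?E3 = (\<Sum>j\<in>O'. g (insert (j, m) R))"
    by (rule sum.reindex_cong[OF inj1]) auto
  also have "sum g ?E4 = (\<Sum>v\<in>V. g (insert (m, v) R))"
    by (rule sum.reindex_cong[OF inj2]) auto
  also have "sum g ?E5 = (\<Sum>(j, v)\<in>O' \<times> V. g (insert (j, m) (insert (m, v) R)))"
    by (rule sum.reindex_cong[OF inj3]) auto
  also have "\<dots> = (\<Sum>j\<in>O'. \<Sum>v\<in>V. g (insert (j, m) (insert (m, v) R)))"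
    by (rule sum.cartesian_product[symmetric])
  finally show ?thesis by simp
qed

section \<open>Step weights and the Motzkin path recurrence\<close>

text \<open>The weight is built up one row and column at a time, and a placement on \<open>[n]\<^sup>2\<close> with \<open>n - k\<close>
  rooks sits at height \<open>k\<close> of a Motzkin path; the three assumptions say that its up, level and down steps
  have total weights \<open>1\<close>, \<open>\<gamma> k\<close> and \<open>\<beta> k\<close>.\<close>

locale rook_weight =
  fixes w :: "nat \<Rightarrow> (nat \<times> nat) set \<Rightarrow> 'a::comm_ring_1" and \<gamma> \<beta> :: "nat \<Rightarrow> 'a"
  assumes weight_up: "R \<in> rooks n \<Longrightarrow> w (Suc n) R = 1"
    and weight_level: "R \<in> rooks n \<Longrightarrow> w (Suc n) (insert (Suc n, Suc n) R)
        + (\<Sum>j\<in>free_rows n R. w (Suc n) (insert (j, Suc n) R))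
        + (\<Sum>v\<in>free_cols n R. w (Suc n) (insert (Suc n, v) R)) = \<gamma> (n - card R)"
    and weight_down: "R \<in> rooks n \<Longrightarrow>
        (\<Sum>j\<in>free_rows n R. \<Sum>v\<in>free_cols n R.
          w (Suc n) (insert (j, Suc n) (insert (Suc n, v) R))) = \<beta> (n - card R)"
begin

definition weight :: "nat \<Rightarrow> (nat \<times> nat) set \<Rightarrow> 'a" where
  "weight n R = (\<Prod>m=1..n. w m (corner m R))"

definition total :: "nat \<Rightarrow> nat \<Rightarrow> 'a" where
  "total n k = (\<Sum>R\<in>rooks n. if card R + k = n then weight n R else 0)"

lemma weight_Suc:
  assumes "S \<in> rooks (Suc n)"
  shows "weight (Suc n) S = weight n (corner n S) * w (Suc n) S"
proof -
  have "weight n (corner n S) = (\<Prod>m=1..n. w m (corner m S))"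
    unfolding weight_def by (rule prod.cong) (auto simp: corner_corner)
  then show ?thesis
    using assms by (simp add: weight_def corner_self)
qed

lemma total_0: "total 0 k = (if k = 0 then 1 else 0)"
proof -
  have "rooks 0 = {{}}" by (auto simp: rooks_def)
  then show ?thesis by (simp add: total_def weight_def)
qed

text \<open>Placements on the larger board are grouped by their corner of size n. Height k is
  reached from heights k - 1, k and k + 1 by an up, level or down step, whose total weights depend
  on the starting height only.\<close>

lemma total_Suc:
  "total (Suc n) k = (if k = 0 then 0 else total n (k - 1))
    + \<gamma> k * total n k + \<beta> (Suc k) * total n (Suc k)"
proof -
  define g where "g S = (if card S + k = Suc n then weight (Suc n) S else 0)" for S
  define m where "m = Suc n"
  have ext: "(\<Sum>S | S \<in> rooks (Suc n) \<and> corner n S = R. g S)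
    = (if k = 0 then 0 else if card R + (k - 1) = n then weight n R else 0)
      + \<gamma> k * (if card R + k = n then weight n R else 0)
      + \<beta> (Suc k) * (if card R + Suc k = n then weight n R else 0)"
    if R: "R \<in> rooks n" for R
  proof -
    have bd: "(m, a) \<notin> R" "(a, m) \<notin> R" for a
      using rooksD(1)[OF R, of a m] rooksD(1)[OF R, of m a] by (auto simp: m_def)
    have OV: "m \<notin> free_rows n R" "m \<notin> free_cols n R"
      by (auto simp: m_def free_rows_def free_cols_def)
    have fin: "finite R" using R by (rule finite_rook)
    have W: "weight (Suc n) S = weight n R * w m S" if "S \<in> rooks (Suc n)" "corner n S = R" for S
      using weight_Suc[OF that(1)] that(2) by (simp add: m_def)
    note mem = rook_extensions[OF R, folded m_def, THEN eqset_imp_iff, THEN iffD2, simplified]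
    have g1: "g R = (if card R + k = Suc n then weight n R else 0)"
      using W[of R] mem[of R] weight_up[OF R] by (simp add: g_def m_def)
    have g2: "g (insert (m, m) R) = (if card R + k = n then weight n R * w m (insert (m, m) R) else 0)"
      using W[of "insert (m, m) R"] mem[of "insert (m, m) R"] bd fin by (simp add: g_def m_def)
    have g3: "g (insert (j, m) R) = (if card R + k = n then weight n R * w m (insert (j, m) R) else 0)"
      if "j \<in> free_rows n R" for j
      using W[of "insert (j, m) R"] mem[of "insert (j, m) R"] bd fin that by (auto simp: g_def m_def)
    have g4: "g (insert (m, v) R) = (if card R + k = n then weight n R * w m (insert (m, v) R) else 0)"
      if "v \<in> free_cols n R" for v
      using W[of "insert (m, v) R"] mem[of "insert (m, v) R"] bd fin that by (auto simp: g_def m_def)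
    have g5: "g (insert (j, m) (insert (m, v) R))
        = (if card R + Suc k = n then weight n R * w m (insert (j, m) (insert (m, v) R)) else 0)"
      if "j \<in> free_rows n R" "v \<in> free_cols n R" for j v
    proof -
      let ?S = "insert (j, m) (insert (m, v) R)"
      have "card ?S = Suc (Suc (card R))"
      proof -
        have "j \<noteq> m" using that OV by auto
        then show ?thesis using bd fin by simp
      qed
      moreover have "weight (Suc n) ?S = weight n R * w m ?S"
      proof -
        have "?S \<in> {S \<in> rooks (Suc n). corner n S = R}"
          unfolding rook_extensions[OF R]
          by (intro UnI2 image_eqI[of _ _ "(j, v)"]) (use that in \<open>simp_all add: m_def\<close>)
        then show ?thesis using W[of ?S] by blast
      qed
      ultimately show ?thesis by (simp add: g_def)
    qed
    have "(\<Sum>S | S \<in> rooks (Suc n) \<and> corner n S = R. g S)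
      = (if card R + k = Suc n then weight n R else 0)
       + (if card R + k = n then weight n R * (w m (insert (m, m) R)
        + (\<Sum>j\<in>free_rows n R. w m (insert (j, m) R))
        + (\<Sum>v\<in>free_cols n R. w m (insert (m, v) R))) else 0)
       + (if card R + Suc k = n then weight n R * (\<Sum>j\<in>free_rows n R. \<Sum>v\<in>free_cols n R.
          w m (insert (j, m) (insert (m, v) R))) else 0)"
      unfolding sum_rook_extensions[OF R] m_def
      by (simp add: g1[unfolded m_def] g2[unfolded m_def] g3[unfolded m_def] g4[unfolded m_def] g5[unfolded m_def] sum_distrib_left algebra_simps)
    also have "\<dots> = (if card R + k = Suc n then weight n R else 0)
       + (if card R + k = n then weight n R * \<gamma> (n - card R) else 0)
       + (if card R + Suc k = n then weight n R * \<beta> (n - card R) else 0)"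
      by (simp only: m_def weight_level[OF R] weight_down[OF R])
    also have "\<dots> = (if k = 0 then 0 else if card R + (k - 1) = n then weight n R else 0)
      + \<gamma> k * (if card R + k = n then weight n R else 0)
      + \<beta> (Suc k) * (if card R + Suc k = n then weight n R else 0)"
    proof (intro arg_cong2[of _ _ _ _ "(+)"])
      \<comment> \<open>For k = 0 the left side would require n + 1 rooks on a board with n
        rows.\<close>
      show "(if card R + k = Suc n then weight n R else 0)
          = (if k = 0 then 0 else if card R + (k - 1) = n then weight n R else 0)"
        using card_rook_le[OF R] by auto
      show "(if card R + k = n then weight n R * \<gamma> (n - card R) else 0)
          = \<gamma> k * (if card R + k = n then weight n R else 0)"
        by (auto simp: mult.commute)
      have "n - card R = Suc k" if "card R + Suc k = n"
        using that by simp
      then show "(if card R + Suc k = n then weight n R * \<beta> (n - card R) else 0)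
          = \<beta> (Suc k) * (if card R + Suc k = n then weight n R else 0)"
        by (simp add: mult.commute)
    qed
    finally show ?thesis .
  qed
  have "total (Suc n) k = sum g (rooks (Suc n))"
    by (simp add: total_def g_def)
  also have "\<dots> = (\<Sum>R\<in>rooks n. \<Sum>S | S \<in> rooks (Suc n) \<and> corner n S = R. g S)"
    by (rule sum.group[symmetric]) (auto simp: finite_rooks corner_in_rooks)
  also have "\<dots> = (if k = 0 then 0 else total n (k - 1))
    + \<gamma> k * total n k + \<beta> (Suc k) * total n (Suc k)"
    by (simp add: ext sum.distrib total_def sum_distrib_left)
  finally show ?thesis .
qed

end

section \<open>Permutations as full placements\<close>

definition graph_on :: "nat \<Rightarrow> (nat \<Rightarrow> nat) \<Rightarrow> (nat \<times> nat) set" where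
  "graph_on n \<sigma> = (\<lambda>i. (i, \<sigma> i)) ` {1..n}"

lemma graph_on_iff: "(i, j) \<in> graph_on n \<sigma> \<longleftrightarrow> i \<in> {1..n} \<and> j = \<sigma> i"
  by (auto simp: graph_on_def)

text \<open>With n rooks every row is occupied, so the placement is the graph of an injective
  self-map of the finite set \<open>{1..n}\<close>, which is then bijective.\<close>

lemma bij_betw_graph_on:
  "bij_betw (graph_on n) {\<sigma>. \<sigma> permutes {1..n}} {R \<in> rooks n. card R = n}"
proof (rule bij_betw_imageI)
  show "inj_on (graph_on n) {\<sigma>. \<sigma> permutes {1..n}}"
  proof (rule inj_onI, clarify)
    fix \<sigma> \<tau> assume *: "\<sigma> permutes {1..n}" "\<tau> permutes {1..n}" "graph_on n \<sigma> = graph_on n \<tau>"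
    show "\<sigma> = \<tau>"
    proof
      fix i
      show "\<sigma> i = \<tau> i"
      proof (cases "i \<in> {1..n}")
        case True
        then have "(i, \<sigma> i) \<in> graph_on n \<tau>" by (simp add: *(3)[symmetric] graph_on_iff)
        then show ?thesis by (simp add: graph_on_iff)
      next
        case False
        then show ?thesis using *(1,2) by (simp add: permutes_not_in)
      qed
    qed
  qed
  show "graph_on n ` {\<sigma>. \<sigma> permutes {1..n}} = {R \<in> rooks n. card R = n}"
  proof (intro equalityI subsetI)
    fix R assume "R \<in> graph_on n ` {\<sigma>. \<sigma> permutes {1..n}}"
    then obtain \<sigma> where s: "\<sigma> permutes {1..n}" and R: "R = graph_on n \<sigma>" by auto
    have "card R = n"
      unfolding R graph_on_def by (subst card_image) (auto simp: inj_on_def)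
    moreover have "R \<subseteq> {1..n} \<times> {1..n}"
      using permutes_in_image[OF s] unfolding R graph_on_def by blast
    moreover have "single_valued R" "single_valued (R\<inverse>)"
      using permutes_inj[OF s] by (auto simp: R graph_on_def single_valued_def inj_def)
    ultimately show "R \<in> {R \<in> rooks n. card R = n}" by (simp add: rooks_def)
  next
    fix R assume "R \<in> {R \<in> rooks n. card R = n}"
    then have R: "R \<in> rooks n" and cR: "card R = n" by auto
    have dom: "Domain R = {1..n}"
      by (rule card_subset_eq) (use Domain_rook[OF R] card_Domain_rook[OF R] cR in auto)
    \<comment> \<open>The value i outside \<open>{1..n}\<close> is forced by
      \<open>permutes\<close>.\<close>
    define \<sigma> where "\<sigma> i = (if i \<in> {1..n} then THE j. (i, j) \<in> R else i)" for i
    have s: "\<sigma> i = j" if "(i, j) \<in> R" for i j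
    proof -
      have "(THE j. (i, j) \<in> R) = j"
        using that rooksD(2)[OF R] by blast
      then show ?thesis using that dom by (auto simp: \<sigma>_def)
    qed
    have RG: "R = graph_on n \<sigma>"
      using s dom by (fastforce simp: graph_on_iff)
    have mem: "(i, \<sigma> i) \<in> R" if "i \<in> {1..n}" for i
      using that by (simp add: RG graph_on_iff)
    have "inj_on \<sigma> {1..n}"
      using mem rooksD(3)[OF R] by (metis inj_onI)
    moreover have "\<sigma> ` {1..n} \<subseteq> {1..n}"
      using mem rooksD(1)[OF R] by fastforce
    ultimately have "bij_betw \<sigma> {1..n} {1..n}"
      by (simp add: bij_betw_def endo_inj_surj)
    then have "\<sigma> permutes {1..n}"
      by (rule bij_imp_permutes) (auto simp: \<sigma>_def)
    then show "R \<in> graph_on n ` {\<sigma>. \<sigma> permutes {1..n}}" using RG by auto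
  qed
qed

text \<open>Permutations are the placements of height 0, so F is column 0 of the array
  \<open>total\<close>.\<close>

theorem (in rook_weight) permutation_sum_eq_jfrac:
  assumes "\<And>n. F n = (\<Sum>\<sigma> | \<sigma> permutes {1..n}. \<Prod>m=1..n. w m (corner m (graph_on n \<sigma>)))"
  shows "Abs_fps F = jfrac \<gamma> \<beta>"
proof -
  have "F n = total n 0" for n
  proof -
    have "F n = (\<Sum>\<sigma> | \<sigma> permutes {1..n}. weight n (graph_on n \<sigma>))"
      by (simp add: assms weight_def)
    also have "\<dots> = (\<Sum>R | R \<in> rooks n \<and> card R = n. weight n R)"
      by (rule sum.reindex_bij_betw[OF bij_betw_graph_on])
    also have "\<dots> = total n 0"
      by (simp add: total_def sum.inter_filter finite_rooks)
    finally show ?thesis .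
  qed
  then have "F = (\<lambda>n. total n 0)" by auto
  then show ?thesis
    using jfrac_eq_column_zero[of total \<gamma> \<beta>, OF total_0 total_Suc] by simp
qed

lemma prod_if_power:
  "finite A \<Longrightarrow> (\<Prod>m\<in>A. if P m then x else 1) = (x :: 'a::comm_monoid_mult) ^ card {m \<in> A. P m}"
  by (simp add: prod.inter_filter[symmetric])

lemma corner_graph_on_iff:
  "m \<le> n \<Longrightarrow> (i, j) \<in> corner m (graph_on n \<sigma>) \<longleftrightarrow> i \<in> {1..m} \<and> j \<in> {1..m} \<and> j = \<sigma> i"
  by (auto simp: corner_def graph_on_iff)


section \<open>Weak excedances in the middle of a decreasing triple\<close>

text \<open>Only \<open>Min A\<close> gets weight 1. The empty set is separate because the formula
  would give 1 - x there.\<close>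

lemma sum_if_not_least:
  fixes A :: "nat set" and x :: "'a::comm_ring_1"
  assumes "finite A"
  shows "(\<Sum>j\<in>A. if \<exists>i\<in>A. i < j then x else 1)
    = (if A = {} then 0 else 1 + (of_nat (card A) - 1) * x)"
proof (cases "A = {}")
  case False
  define a where "a = Min A"
  have a: "a \<in> A" "\<And>i. i \<in> A \<Longrightarrow> a \<le> i"
    using assms False by (auto simp: a_def)
  have "(\<Sum>j\<in>A. if \<exists>i\<in>A. i < j then x else 1)
      = (if \<exists>i\<in>A. i < a then x else 1) + (\<Sum>j\<in>A - {a}. if \<exists>i\<in>A. i < j then x else 1)"
    by (rule sum.remove) (use assms a in auto)
  also have "(\<Sum>j\<in>A - {a}. if \<exists>i\<in>A. i < j then x else 1) = (\<Sum>j\<in>A - {a}. x)"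
    by (rule sum.cong) (use a in \<open>auto simp: order.strict_iff_order\<close>)
  also have "\<dots> = (of_nat (card A) - 1) * x"
    using assms a False by (simp add: of_nat_diff Suc_le_eq card_gt_0_iff)
  also have "(if \<exists>i\<in>A. i < a then x else 1) = 1"
    using a(2) by (auto dest: leD)
  finally show ?thesis using False by simp
qed simp

text \<open>In the placement of a permutation \<open>\<sigma>\<close>, a row \<open>i\<close> is missing from \<open>corner m\<close> iff \<open>\<sigma> i > m\<close>; so with \<open>\<sigma> j = m\<close>
  this says that \<open>j\<close> is a weak excedance but not a left-to-right maximum.\<close>

definition wexx_at :: "nat \<Rightarrow> (nat \<times> nat) set \<Rightarrow> bool" where
  "wexx_at m S \<longleftrightarrow> (\<exists>j i. (j, m) \<in> S \<and> 1 \<le> i \<and> i < j \<and> i \<notin> Domain S)"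

text \<open>If no k > j had a smaller value than j, the n - j + 2 positions i, j, ..., n would map
  injectively into \<open>{\<sigma> j..n}\<close>, which has at most n - j + 1 elements because j
  \<le> \<open>\<sigma> j\<close>.\<close>

lemma decreasing_triple_iff:
  fixes n :: nat
  assumes s: "\<sigma> permutes {1..n}" and j: "j \<in> {1..n}" "j \<le> \<sigma> j"
  shows "(\<exists>i\<in>{1..n}. \<exists>k\<in>{1..n}. i < j \<and> j < k \<and> \<sigma> i > \<sigma> j \<and> \<sigma> j > \<sigma> k)
    \<longleftrightarrow> (\<exists>i\<ge>1. i < j \<and> \<sigma> i > \<sigma> j)" (is "?L \<longleftrightarrow> ?R")
proof
  assume ?R
  then obtain i where i: "1 \<le> i" "i < j" "\<sigma> i > \<sigma> j" by auto
  have bd: "\<sigma> k \<in> {1..n}" if "k \<in> {1..n}" for k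
    using that permutes_in_image[OF s] by blast
  have "\<exists>k\<in>{1..n}. j < k \<and> \<sigma> j > \<sigma> k"
  proof (rule ccontr)
    assume *: "\<not> (\<exists>k\<in>{1..n}. j < k \<and> \<sigma> j > \<sigma> k)"
    have "\<sigma> ` insert i {j..n} \<subseteq> {\<sigma> j..n}"
    proof
      fix y assume "y \<in> \<sigma> ` insert i {j..n}"
      then obtain k where k: "y = \<sigma> k" "k = i \<or> k \<in> {j..n}" by auto
      then have "k \<in> {1..n}" using i j by auto
      moreover have "\<sigma> j \<le> \<sigma> k"
        using k(2) * i calculation by (cases "k = j") (auto simp: not_less dest: bspec[of _ _ k])
      ultimately show "y \<in> {\<sigma> j..n}" using bd[of k] k(1) by auto
    qed
    then have "card (\<sigma> ` insert i {j..n}) \<le> card {\<sigma> j..n}"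
      by (intro card_mono) auto
    moreover have "card (\<sigma> ` insert i {j..n}) = card (insert i {j..n})"
      by (rule card_image) (use permutes_inj[OF s] in \<open>auto simp: inj_on_def inj_def\<close>)
    ultimately show False using i j bd[OF j(1)] by auto
  qed
  then show ?L using i j by force
qed auto

text \<open>\<open>wexx\<close> counts positions j, while \<open>wexx_at\<close> is indexed by
  values m = \<open>\<sigma> j\<close>, so the two sets correspond under \<sigma>. Weak excedance
  means that the rook of column m already lies in corner m.\<close>

lemma wexx_eq:
  assumes s: "\<sigma> permutes {1..n}"
  shows "wexx n \<sigma> = card {m \<in> {1..n}. wexx_at m (corner m (graph_on n \<sigma>))}"
proof -
  define A where "A = {j \<in> {1..n}. j \<le> \<sigma> j \<and> (\<exists>i\<ge>1. i < j \<and> \<sigma> i > \<sigma> j)}"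
  have bd: "\<sigma> k \<in> {1..n} \<longleftrightarrow> k \<in> {1..n}" for k
    using permutes_in_image[OF s] by blast
  have "wexx n \<sigma> = card A"
    unfolding wexx_def A_def using decreasing_triple_iff[OF s]
    by (intro arg_cong[of _ _ card]) blast
  also have "\<dots> = card (\<sigma> ` A)"
    by (rule card_image[symmetric]) (use permutes_inj[OF s] in \<open>auto simp: inj_on_def inj_def\<close>)
  also have "\<sigma> ` A = {m \<in> {1..n}. wexx_at m (corner m (graph_on n \<sigma>))}"
  proof (intro equalityI subsetI)
    fix m assume "m \<in> \<sigma> ` A"
    then obtain j i where j: "m = \<sigma> j" "j \<in> {1..n}" "j \<le> \<sigma> j" "1 \<le> i" "i < j" "\<sigma> i > \<sigma> j"
      by (auto simp: A_def)
    have m: "m \<in> {1..n}" using j(1,2) by (simp only: bd)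
    then have mn: "m \<le> n" by simp
    have "(j, m) \<in> corner m (graph_on n \<sigma>)"
      unfolding corner_graph_on_iff[OF mn] using j m by auto
    moreover have "i \<notin> Domain (corner m (graph_on n \<sigma>))"
      unfolding Domain_iff corner_graph_on_iff[OF mn] using j by auto
    ultimately show "m \<in> {m \<in> {1..n}. wexx_at m (corner m (graph_on n \<sigma>))}"
      using j m by (auto simp: wexx_at_def)
  next
    fix m assume "m \<in> {m \<in> {1..n}. wexx_at m (corner m (graph_on n \<sigma>))}"
    then obtain i j where m: "m \<in> {1..n}" and j: "(j, m) \<in> corner m (graph_on n \<sigma>)"
      "1 \<le> i" "i < j" "i \<notin> Domain (corner m (graph_on n \<sigma>))"
      by (auto simp: wexx_at_def)
    have mn: "m \<le> n" using m by simp
    have j': "m = \<sigma> j" "1 \<le> j" "j \<le> m" using j(1) by (auto simp: corner_graph_on_iff[OF mn])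
    have "\<sigma> i \<in> {1..n}" using bd[of i] j j' mn by auto
    then have "\<sigma> i > \<sigma> j"
      using j(2-4) j' unfolding corner_graph_on_iff[OF mn] Domain_iff by auto
    then show "m \<in> \<sigma> ` A" using j j' mn by (auto simp: A_def)
  qed
  finally show ?thesis .
qed

text \<open>For k > 0 free rows the level step collects x from the diagonal,
  \<open>1 + (k - 1) * x\<close> from the new column and k from the new row; for k = 0 only the
  diagonal is left, with weight 1. In the down step the choice of v is immaterial and contributes a
  factor k.\<close>

lemma rook_weight_wexx:
  fixes x :: "'a::comm_ring_1"
  shows "rook_weight (\<lambda>m S. if wexx_at m S then x else 1)
    (\<lambda>n. (of_nat n + 1) + of_nat n * x) (\<lambda>n. of_nat n * (1 + (of_nat n - 1) * x))"
proof
  fix n R assume R: "R \<in> rooks n"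
  define m where "m = Suc n"
  define O' where "O' = free_rows n R"
  define V where "V = free_cols n R"
  define w where "w S = (if wexx_at m S then x else 1)" for S
  have bd: "(m, a) \<notin> R" "(a, m) \<notin> R" for a
    using rooksD(1)[OF R, of a m] rooksD(1)[OF R, of m a] by (auto simp: m_def)
  have O'_iff: "i \<in> O' \<longleftrightarrow> 1 \<le> i \<and> i < m \<and> i \<notin> Domain R" for i
    by (auto simp: O'_def m_def free_rows_def)
  have V_less: "v < m" if "v \<in> V" for v
    using that by (auto simp: V_def m_def free_cols_def)
  have fin: "finite O'" by (simp add: O'_def finite_free)
  have cO: "card O' = n - card R" and cV: "card V = n - card R"
    by (simp_all add: O'_def V_def R card_free_rows card_free_cols)
  have up: "w R = 1" by (simp add: w_def wexx_at_def bd)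
  have diag: "w (insert (m, m) R) = (if O' = {} then 1 else x)"
    using O'_iff by (auto simp: w_def wexx_at_def bd)
  have col: "w (insert (m, v) R) = 1" if "v \<in> V" for v
    using V_less[OF that] by (auto simp: w_def wexx_at_def bd)
  have row: "w (insert (j, m) R) = (if \<exists>i\<in>O'. i < j then x else 1)" if "j \<in> O'" for j
  proof -
    have "wexx_at m (insert (j, m) R) \<longleftrightarrow> (\<exists>i\<in>O'. i < j)"
      using that O'_iff by (auto simp: wexx_at_def bd)
    then show ?thesis by (simp add: w_def)
  qed
  \<comment> \<open>The second rook occupies row m > j, so the rows smaller than j are exactly as
    free as in R.\<close>
  have both: "w (insert (j, m) (insert (m, v) R)) = (if \<exists>i\<in>O'. i < j then x else 1)"
    if "j \<in> O'" "v \<in> V" for j v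
  proof -
    have "wexx_at m (insert (j, m) (insert (m, v) R)) \<longleftrightarrow> (\<exists>i\<in>O'. i < j)"
      using that O'_iff V_less[OF that(2)] by (auto simp: wexx_at_def bd)
    then show ?thesis by (simp add: w_def)
  qed
  show "(if wexx_at (Suc n) R then x else 1) = 1"
    using up by (simp add: w_def m_def)
  have "w (insert (m, m) R) + (\<Sum>j\<in>O'. w (insert (j, m) R)) + (\<Sum>v\<in>V. w (insert (m, v) R))
      = (of_nat (n - card R) + 1) + of_nat (n - card R) * x"
    using cO fin by (auto simp: diag row col sum_if_not_least cV algebra_simps)
  then show "(if wexx_at (Suc n) (insert (Suc n, Suc n) R) then x else 1)
      + (\<Sum>j\<in>free_rows n R. if wexx_at (Suc n) (insert (j, Suc n) R) then x else 1)
      + (\<Sum>v\<in>free_cols n R. if wexx_at (Suc n) (insert (Suc n, v) R) then x else 1)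
      = (of_nat (n - card R) + 1) + of_nat (n - card R) * x"
    by (simp only: w_def O'_def V_def m_def)
  have "(\<Sum>j\<in>O'. \<Sum>v\<in>V. w (insert (j, m) (insert (m, v) R)))
      = of_nat (n - card R) * (1 + (of_nat (n - card R) - 1) * x)"
    using cO fin by (auto simp: both cV sum_distrib_left[symmetric] sum_if_not_least)
  then show "(\<Sum>j\<in>free_rows n R. \<Sum>v\<in>free_cols n R.
        if wexx_at (Suc n) (insert (j, Suc n) (insert (Suc n, v) R)) then x else 1)
      = of_nat (n - card R) * (1 + (of_nat (n - card R) - 1) * x)"
    by (simp only: w_def O'_def V_def m_def)
qed

section \<open>Cycle descents\<close>

text \<open>The negated part says that inserting \<open>m\<close> closes a path to a cycle. It refers to the smaller corner so that
  it is settled once \<open>m\<close> has been inserted.\<close>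

definition cdes_at :: "nat \<Rightarrow> (nat \<times> nat) set \<Rightarrow> bool" where
  "cdes_at m S \<longleftrightarrow> (\<exists>v<m. (m, v) \<in> S \<and>
     \<not> (\<exists>j<m. (j, m) \<in> S \<and> (v, j) \<in> (corner (m - 1) S)\<^sup>*))"

text \<open>The free row j is the end of a path of R, and v is its start. If every ancestor of j had
  a predecessor, the predecessor map would be injective, hence surjective, on the finite set of
  ancestors; then j would itself be a predecessor and row j occupied.\<close>

lemma ex1_path_source:
  assumes R: "R \<in> rooks n" and j: "j \<in> free_rows n R"
  shows "\<exists>!v. v \<in> free_cols n R \<and> (v, j) \<in> R\<^sup>*"
proof (rule ex_ex1I)
  define A where "A = {v. (v, j) \<in> R\<^sup>*}"
  have A: "A \<subseteq> {1..n}"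
  proof
    fix v assume "v \<in> A"
    then show "v \<in> {1..n}"
      unfolding A_def using j rooksD(1)[OF R] by (auto elim: converse_rtranclE simp: free_rows_def)
  qed
  then have fin: "finite A" by (rule finite_subset) simp
  show "\<exists>v. v \<in> free_cols n R \<and> (v, j) \<in> R\<^sup>*"
  proof (rule ccontr)
    assume "\<not> ?thesis"
    then have "\<forall>v\<in>A. \<exists>p. (p, v) \<in> R"
      using A unfolding free_cols_def A_def by blast
    then obtain p where p: "\<And>v. v \<in> A \<Longrightarrow> (p v, v) \<in> R" by metis
    have "p ` A \<subseteq> A"
      using p unfolding A_def by (auto intro: converse_rtrancl_into_rtrancl)
    moreover have "inj_on p A"
      by (rule inj_onI) (use p rooksD(2)[OF R] in metis)
    ultimately have "p ` A = A" using fin by (simp add: endo_inj_surj)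
    moreover have "j \<in> A" by (simp add: A_def)
    ultimately obtain v where "v \<in> A" "j = p v" by blast
    then have "j \<in> Domain R" using p by auto
    then show False using j by (simp add: free_rows_def)
  qed
next
  fix v v'
  assume *: "v \<in> free_cols n R \<and> (v, j) \<in> R\<^sup>*" "v' \<in> free_cols n R \<and> (v', j) \<in> R\<^sup>*"
  \<comment> \<open>Backward walks from j are deterministic, so one of v, v' is an ancestor of the
    other; a free column has no predecessor.\<close>
  have "single_valued (R\<inverse>)" using R by (simp add: rooks_def)
  then have "(v, v') \<in> (R\<inverse>)\<^sup>* \<or> (v', v) \<in> (R\<inverse>)\<^sup>*"
    by (rule single_valued_confluent) (use * in \<open>auto simp: rtrancl_converse\<close>)
  then show "v = v'"
    using * by (auto simp: free_cols_def elim: converse_rtranclE)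
qed

text \<open>With k free rows the level step collects 1 from the diagonal, k from the new column and
  \<open>k * x\<close> from the new row. In the down step, each j has exactly one v that closes a
  cycle, by \<open>ex1_path_source\<close>.\<close>

lemma rook_weight_cdes:
  fixes x :: "'a::comm_ring_1"
  shows "rook_weight (\<lambda>m S. if cdes_at m S then x else 1)
    (\<lambda>n. (of_nat n + 1) + of_nat n * x) (\<lambda>n. of_nat n * (1 + (of_nat n - 1) * x))"
proof
  fix n R assume R: "R \<in> rooks n"
  define m where "m = Suc n"
  define O' where "O' = free_rows n R"
  define V where "V = free_cols n R"
  define w where "w S = (if cdes_at m S then x else 1)" for S
  have bd: "(m, a) \<notin> R" "(a, m) \<notin> R" for a
    using rooksD(1)[OF R, of a m] rooksD(1)[OF R, of m a] by (auto simp: m_def)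
  have O'_less: "j < m" if "j \<in> O'" for j
    using that by (auto simp: O'_def m_def free_rows_def)
  have V_less: "v < m" if "v \<in> V" for v
    using that by (auto simp: V_def m_def free_cols_def)
  have fin: "finite O'" "finite V" by (simp_all add: O'_def V_def finite_free)
  have cO: "card O' = n - card R" and cV: "card V = n - card R"
    by (simp_all add: O'_def V_def R card_free_rows card_free_cols)
  have up: "w R = 1" by (simp add: w_def cdes_at_def bd)
  have diag: "w (insert (m, m) R) = 1"
    by (simp add: w_def cdes_at_def bd)
  have col: "w (insert (m, v) R) = x" if "v \<in> V" for v
    using V_less[OF that] by (auto simp: w_def cdes_at_def bd)
  have row: "w (insert (j, m) R) = 1" if "j \<in> O'" for j
    using O'_less[OF that] by (auto simp: w_def cdes_at_def bd)
  have both: "w (insert (j, m) (insert (m, v) R)) = (if (v, j) \<in> R\<^sup>* then 1 else x)"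
    if "j \<in> O'" "v \<in> V" for j v
  proof -
    have "corner (m - 1) (insert (j, m) (insert (m, v) R)) = R"
      using R by (auto simp: corner_def m_def rooks_def)
    then have "cdes_at m (insert (j, m) (insert (m, v) R)) \<longleftrightarrow> (v, j) \<notin> R\<^sup>*"
      using O'_less[OF that(1)] V_less[OF that(2)] by (auto simp: cdes_at_def bd)
    then show ?thesis by (simp add: w_def)
  qed
  have source: "(\<Sum>v\<in>V. if (v, j) \<in> R\<^sup>* then 1 else x) = 1 + (of_nat (n - card R) - 1) * x"
    if j: "j \<in> O'" for j
  proof -
    obtain v0 where v0: "v0 \<in> V" "(v0, j) \<in> R\<^sup>*" "\<And>v. v \<in> V - {v0} \<Longrightarrow> (v, j) \<notin> R\<^sup>*"
      using ex1_path_source[OF R, of j] j unfolding O'_def V_def by blast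
    have "(\<Sum>v\<in>V. if (v, j) \<in> R\<^sup>* then 1 else x)
        = (if (v0, j) \<in> R\<^sup>* then 1 else x) + (\<Sum>v\<in>V - {v0}. if (v, j) \<in> R\<^sup>* then 1 else x)"
      by (rule sum.remove) (rule fin(2), rule v0(1))
    also have "(\<Sum>v\<in>V - {v0}. if (v, j) \<in> R\<^sup>* then 1 else x) = (\<Sum>v\<in>V - {v0}. x)"
      by (rule sum.cong) (simp_all add: v0(3))
    also have "\<dots> = (of_nat (card V) - 1) * x"
    proof -
      have "card V \<ge> 1" using v0 fin by (auto simp: Suc_le_eq card_gt_0_iff)
      then show ?thesis using v0 fin by (simp add: of_nat_diff)
    qed
    finally show ?thesis using v0 by (simp add: cV)
  qed
  show "(if cdes_at (Suc n) R then x else 1) = 1"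
    using up by (simp add: w_def m_def)
  have "w (insert (m, m) R) + (\<Sum>j\<in>O'. w (insert (j, m) R)) + (\<Sum>v\<in>V. w (insert (m, v) R))
      = (of_nat (n - card R) + 1) + of_nat (n - card R) * x"
    by (simp add: diag row col cO cV algebra_simps)
  then show "(if cdes_at (Suc n) (insert (Suc n, Suc n) R) then x else 1)
      + (\<Sum>j\<in>free_rows n R. if cdes_at (Suc n) (insert (j, Suc n) R) then x else 1)
      + (\<Sum>v\<in>free_cols n R. if cdes_at (Suc n) (insert (Suc n, v) R) then x else 1)
      = (of_nat (n - card R) + 1) + of_nat (n - card R) * x"
    by (simp only: w_def O'_def V_def m_def)
  have "(\<Sum>j\<in>O'. \<Sum>v\<in>V. w (insert (j, m) (insert (m, v) R)))
      = of_nat (n - card R) * (1 + (of_nat (n - card R) - 1) * x)"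
    by (simp add: both source cO)
  then show "(\<Sum>j\<in>free_rows n R. \<Sum>v\<in>free_cols n R.
        if cdes_at (Suc n) (insert (j, Suc n) (insert (Suc n, v) R)) then x else 1)
      = of_nat (n - card R) * (1 + (of_nat (n - card R) - 1) * x)"
    by (simp only: w_def O'_def V_def m_def)
qed

text \<open>The smaller corner is \<sigma> restricted to arguments and values below m. The cycle of
  m runs from \<open>\<sigma> m\<close> back to m inside it exactly when no element of the cycle
  exceeds m.\<close>

lemma closes_cycle_iff:
  assumes s: "\<sigma> permutes {1..n}" and m: "m \<in> {1..n}" "\<sigma> m < m"
  shows "(\<exists>j<m. (j, m) \<in> corner m (graph_on n \<sigma>)
       \<and> (\<sigma> m, j) \<in> (corner (m - 1) (graph_on n \<sigma>))\<^sup>*) \<longleftrightarrow> m = Max (orbit \<sigma> m)"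
proof -
  define C where "C = corner (m - 1) (graph_on n \<sigma>)"
  have perm: "permutation \<sigma>" using s by (auto intro: permutation_permutes[THEN iffD2])
  have self: "m \<in> orbit \<sigma> m" by (rule permutation_self_in_orbit[OF perm])
  have fin: "finite (orbit \<sigma> m)" by (rule finite_orbit[OF self])
  have C_iff: "(a, b) \<in> C \<longleftrightarrow> 1 \<le> a \<and> a < m \<and> 1 \<le> b \<and> b < m \<and> b = \<sigma> a" for a b
    using m by (auto simp: C_def corner_graph_on_iff)
  have G_iff: "(a, b) \<in> corner m (graph_on n \<sigma>) \<longleftrightarrow> 1 \<le> a \<and> a \<le> m \<and> 1 \<le> b \<and> b \<le> m \<and> b = \<sigma> a"
    for a b
    using m by (auto simp: corner_graph_on_iff)
  show ?thesis
    unfolding C_def[symmetric]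
  proof
    assume "\<exists>j<m. (j, m) \<in> corner m (graph_on n \<sigma>) \<and> (\<sigma> m, j) \<in> C\<^sup>*"
    then obtain j where j: "j < m" "\<sigma> j = m" "(\<sigma> m, j) \<in> C\<^sup>*"
      by (auto simp: G_iff)
    have le: "a < m" if "(\<sigma> m, a) \<in> C\<^sup>*" for a
      using that by (cases rule: rtranclE) (use m(2) in \<open>auto simp: C_iff\<close>)
    \<comment> \<open>Invariant for following the orbit: each point lies on the path from
      \<open>\<sigma> m\<close> to j, and after j the walk is back at m.\<close>
    have step: "\<sigma> a = m \<or> (\<sigma> m, \<sigma> a) \<in> C\<^sup>* \<and> (\<sigma> a, j) \<in> C\<^sup>*"
      if "(\<sigma> m, a) \<in> C\<^sup>*" "(a, j) \<in> C\<^sup>*" for a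
      using that(2)
    proof (cases rule: converse_rtranclE)
      case base
      then show ?thesis using j by simp
    next
      case (step b)
      then have "b = \<sigma> a" by (simp add: C_iff)
      then show ?thesis using step that(1) by (auto intro: rtrancl_into_rtrancl)
    qed
    have "x = m \<or> (\<sigma> m, x) \<in> C\<^sup>* \<and> (x, j) \<in> C\<^sup>*" if "x \<in> orbit \<sigma> m" for x
      using that by induction (use j(3) step in auto)
    then have "x \<le> m" if "x \<in> orbit \<sigma> m" for x
      using that le by force
    then show "m = Max (orbit \<sigma> m)" using self fin by (intro Max_eqI[symmetric]) auto
  next
    assume "m = Max (orbit \<sigma> m)"
    then have le: "x \<le> m" if "x \<in> orbit \<sigma> m" for x
      using that fin by (metis Max_ge)
    have in_n: "x \<in> {1..n}" if "x \<in> orbit \<sigma> m" for x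
      using that permutes_orbit_subset[OF s m(1)] by blast
    \<comment> \<open>As nothing in the orbit exceeds m, every step of \<sigma> that neither leaves
      nor enters m is an edge of C.\<close>
    have reach: "x = m \<or> (\<sigma> m, x) \<in> C\<^sup>*" if "x \<in> orbit \<sigma> m" for x
      using that
    proof induction
      case base
      then show ?case by simp
    next
      case (step x)
      have 1: "x \<in> {1..n}" "\<sigma> x \<in> {1..n}" "x \<le> m" "\<sigma> x \<le> m"
        using step.hyps in_n le by (auto intro: orbit.step)
      show ?case
      proof (cases "x = m \<or> \<sigma> x = m")
        case False
        then have "(x, \<sigma> x) \<in> C" using 1 by (auto simp: C_iff)
        then show ?thesis using step.IH False by (auto intro: rtrancl_into_rtrancl)
      qed auto
    qed
    from self obtain j where j: "j \<in> orbit \<sigma> m" "m = \<sigma> j"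
      using m(2) by (cases rule: orbit.cases) auto
    then have "j \<noteq> m" using m(2) by auto
    have jm: "(j, m) \<in> corner m (graph_on n \<sigma>)"
      unfolding G_iff using in_n[OF j(1)] le[OF j(1)] j(2) m by auto
    from \<open>j \<noteq> m\<close> have "j < m" "(\<sigma> m, j) \<in> C\<^sup>*" using le[OF j(1)] reach[OF j(1)] by auto
    then show "\<exists>j<m. (j, m) \<in> corner m (graph_on n \<sigma>) \<and> (\<sigma> m, j) \<in> C\<^sup>*"
      using jm by blast
  qed
qed

text \<open>Both sides count the cycles of length at least two: each contains exactly one drop from its maximum and exactly
  one drop to its minimum.\<close>

lemma card_drop_from_Max_eq_card_drop_to_Min:
  fixes n :: nat
  assumes s: "\<sigma> permutes {1..n}"
  shows "card {i \<in> {1..n}. \<sigma> i < i \<and> i = Max (orbit \<sigma> i)}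
    = card {i \<in> {1..n}. \<sigma> i < i \<and> \<sigma> i = Min (orbit \<sigma> (\<sigma> i))}" (is "card ?A = card ?B")
proof -
  have perm: "permutation \<sigma>" using s by (auto intro: permutation_permutes[THEN iffD2])
  have self: "i \<in> orbit \<sigma> i" for i by (rule permutation_self_in_orbit[OF perm])
  have fin: "finite (orbit \<sigma> i)" for i by (rule finite_orbit[OF self])
  have eq: "orbit \<sigma> (\<sigma> i) = orbit \<sigma> i" for i by (rule permutation_orbit_step[OF perm])
  have eqI: "orbit \<sigma> j = orbit \<sigma> i" if "j \<in> orbit \<sigma> i" for i j
    using that by (rule orbit_cyclic_eq3[OF cyclic_on_orbit'[OF perm]])
  have nofix: "\<sigma> j \<noteq> j" if "j \<in> orbit \<sigma> i" "\<sigma> i \<noteq> i" for i j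
  proof
    assume "\<sigma> j = j"
    then have "orbit \<sigma> j = {j}" by (simp add: orbit_eq_singleton_iff)
    then have "i = j" using eqI[OF that(1)] self[of i] by simp
    then show False using that \<open>\<sigma> j = j\<close> by simp
  qed
  have in_n: "i \<in> {1..n}" if "\<sigma> i \<noteq> i" for i
    using that s by (metis permutes_not_in)
  let ?O = "orbit \<sigma> ` {i. \<sigma> i \<noteq> i}"
  have "orbit \<sigma> ` ?A = ?O"
  proof (intro equalityI subsetI)
    fix X assume "X \<in> ?O"
    then obtain i where i: "X = orbit \<sigma> i" "\<sigma> i \<noteq> i" by auto
    define M where "M = Max (orbit \<sigma> i)"
    have M: "M \<in> orbit \<sigma> i" unfolding M_def by (rule Max_in) (use fin self in auto)
    have "\<sigma> M \<le> M" unfolding M_def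
      by (rule Max_ge) (use fin M in \<open>auto simp: M_def[symmetric] intro: orbit.step\<close>)
    then have "M \<in> ?A"
      using nofix[OF M i(2)] in_n[of M] eqI[OF M] by (auto simp: M_def)
    then show "X \<in> orbit \<sigma> ` ?A" using eqI[OF M] i by blast
  qed auto
  moreover have "orbit \<sigma> ` ?B = ?O"
  proof (intro equalityI subsetI)
    fix X assume "X \<in> ?O"
    then obtain i where i: "X = orbit \<sigma> i" "\<sigma> i \<noteq> i" by auto
    define M where "M = Min (orbit \<sigma> i)"
    have M: "M \<in> orbit \<sigma> i" unfolding M_def by (rule Min_in) (use fin self in auto)
    \<comment> \<open>The predecessor of the minimum on its cycle is where the drop to the minimum
      starts.\<close>
    from M obtain p where p: "p \<in> orbit \<sigma> i" "M = \<sigma> p"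
      by (cases rule: orbit.cases) (use self in auto)
    have "M \<le> p" unfolding M_def by (rule Min_le) (use fin p in auto)
    then have "p \<in> ?B"
      using nofix[OF p(1) i(2)] in_n[of p] eqI[OF p(1)] eq p(2) by (auto simp: M_def)
    then show "X \<in> orbit \<sigma> ` ?B" using eqI[OF p(1)] i by blast
  qed auto
  moreover have "inj_on (orbit \<sigma>) ?A"
    by (rule inj_onI) auto
  moreover have "inj_on (orbit \<sigma>) ?B"
  proof (rule inj_onI)
    fix i j assume "i \<in> ?B" "j \<in> ?B" "orbit \<sigma> i = orbit \<sigma> j"
    then have "\<sigma> i = \<sigma> j" using eq by simp
    then show "i = j" using permutes_inj[OF s] by (simp add: inj_eq)
  qed
  ultimately show ?thesis using card_image[of "orbit \<sigma>" ?A] card_image[of "orbit \<sigma>" ?B] by simp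
qed

text \<open>\<open>cdes\<close> discards the drops to a cycle minimum, \<open>cdes_at\<close> those
  from a cycle maximum. The discarded sets differ in general but are equinumerous subsets of the
  drops.\<close>

lemma cdes_eq:
  assumes s: "\<sigma> permutes {1..n}"
  shows "cdes n \<sigma> = card {m \<in> {1..n}. cdes_at m (corner m (graph_on n \<sigma>))}"
proof -
  let ?D = "{i \<in> {1..n}. \<sigma> i < i}"
  let ?A = "{i \<in> {1..n}. \<sigma> i < i \<and> i = Max (orbit \<sigma> i)}"
  let ?B = "{i \<in> {1..n}. \<sigma> i < i \<and> \<sigma> i = Min (orbit \<sigma> (\<sigma> i))}"
  have at: "cdes_at m (corner m (graph_on n \<sigma>)) \<longleftrightarrow> \<sigma> m < m \<and> m \<noteq> Max (orbit \<sigma> m)"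
    if "m \<in> {1..n}" for m
  proof -
    have mn: "m \<le> n" "1 \<le> m" using that by auto
    have "1 \<le> \<sigma> m" using permutes_in_image[OF s, of m] that by simp
    then have "cdes_at m (corner m (graph_on n \<sigma>)) \<longleftrightarrow> \<sigma> m < m
      \<and> \<not> (\<exists>j<m. (j, m) \<in> corner m (graph_on n \<sigma>)
        \<and> (\<sigma> m, j) \<in> (corner (m - 1) (graph_on n \<sigma>))\<^sup>*)"
      using mn unfolding cdes_at_def corner_corner[OF diff_le_self]
      by (auto simp: corner_graph_on_iff[OF mn(1)])
    then show ?thesis using closes_cycle_iff[OF s that] by blast
  qed
  have "cdes n \<sigma> = card (?D - ?B)"
    unfolding cdes_def by (rule arg_cong[of _ _ card]) auto
  also have "\<dots> = card ?D - card ?B"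
    by (rule card_Diff_subset) auto
  also have "\<dots> = card ?D - card ?A"
    by (simp only: card_drop_from_Max_eq_card_drop_to_Min[OF s])
  also have "\<dots> = card (?D - ?A)"
    by (rule card_Diff_subset[symmetric]) auto
  also have "?D - ?A = {m \<in> {1..n}. cdes_at m (corner m (graph_on n \<sigma>))}"
    using at by auto
  finally show ?thesis .
qed

section \<open>The continued fractions\<close>

lemma coeff_sum_power:
  "finite A \<Longrightarrow> coeff (\<Sum>a\<in>A. poly_x ^ f a) k = int (card {a \<in> A. f a = k})"
  by (simp add: coeff_sum monom_altdef[of 1, simplified, symmetric] sum.inter_filter[symmetric])

theorem theorem3p9:
  shows "Abs_fps wexx_poly =
           jfrac (\<lambda>n. (of_nat n + 1) + of_nat n * poly_x)
                 (\<lambda>n. of_nat n * (1 + (of_nat n - 1) * poly_x)) \<and>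
         Abs_fps cdes_poly =
           jfrac (\<lambda>n. (of_nat n + 1) + of_nat n * poly_x)
                 (\<lambda>n. of_nat n * (1 + (of_nat n - 1) * poly_x)) \<and>
         (\<forall>n. wexx_poly n = cdes_poly n) \<and>
         (\<forall>n k. card {\<sigma>. \<sigma> permutes {1..n} \<and> wexx n \<sigma> = k} =
                card {\<sigma>. \<sigma> permutes {1..n} \<and> cdes n \<sigma> = k})"
proof -
  let ?J = "jfrac (\<lambda>n. (of_nat n + 1) + of_nat n * poly_x)
                 (\<lambda>n. of_nat n * (1 + (of_nat n - 1) * poly_x))"
  \<comment> \<open>A product of factors x and 1 over the corners is x to the number of corners
    counted, which \<open>wexx_eq\<close> and \<open>cdes_eq\<close> identify with the
    statistics.\<close>
  have W: "Abs_fps wexx_poly = ?J"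
    by (rule rook_weight.permutation_sum_eq_jfrac[OF rook_weight_wexx])
      (simp add: wexx_poly_def wexx_eq prod_if_power)
  have C: "Abs_fps cdes_poly = ?J"
    by (rule rook_weight.permutation_sum_eq_jfrac[OF rook_weight_cdes])
      (simp add: cdes_poly_def cdes_eq prod_if_power)
  have eq: "wexx_poly n = cdes_poly n" for n
    using W C by (metis fps_nth_Abs_fps)
  have "card {\<sigma>. \<sigma> permutes {1..n} \<and> wexx n \<sigma> = k} = card {\<sigma>. \<sigma> permutes {1..n} \<and> cdes n \<sigma> = k}"
    for n k
  proof -
    have "finite {\<sigma>. \<sigma> permutes {1..n}}" by (simp add: finite_permutations)
    then have "coeff (wexx_poly n) k = int (card {\<sigma>. \<sigma> permutes {1..n} \<and> wexx n \<sigma> = k})"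
      and "coeff (cdes_poly n) k = int (card {\<sigma>. \<sigma> permutes {1..n} \<and> cdes n \<sigma> = k})"
      by (simp_all only: wexx_poly_def cdes_poly_def coeff_sum_power mem_Collect_eq)
    then show ?thesis using eq[of n] by simp
  qed
  then show ?thesis using W C eq by blast
qed

end
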